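(* If $p$ and $4p+1$ are both prime, then \[ \sum_{j=1}^{p-1} t_2(j)\left( \sigma(p-j)-4 \sigma\!\left(\tfrac{p-j}{2}\right) \right) = -1. \]
   Context: $t_2(n)=\#\{(x_1,x_2)\in\mathbb{N}_0^2 : n=\frac{x_1(x_1+1)}{2}+\frac{x_2(x_2+1)}{2}\}$, with $\mathbb{N}_0=\{0,1,2,\dots\}$. The function $\sigma$ is defined on $\mathbb{Q}$ by $\sigma(0)=1$, $\sigma(q)=0$ if $q\in\mathbb{Q}\setminus\mathbb{N}_0$, and $\sigma(q)=\sum_{d\mid q} d$ for $q\in\mathbb{N}=\{1,2,\dots\}$. *)

theory Defs
  imports "HOL-Number_Theory.Number_Theory"
begin

text \<open>Number of ordered representations of n as a sum of two triangular numbers;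
  the natural number division by 2 is exact because x(x+1) is even.\<close>
definition t2 :: "nat \<Rightarrow> nat" where
  "t2 n = card {(x1, x2). n = x1 * (x1 + 1) div 2 + x2 * (x2 + 1) div 2}"

text \<open>The divisor sum extended to the rationals, with the convention that its value
  at 0 is 1. On a positive natural number q, \<open>nat \<lfloor>q\<rfloor>\<close> is q itself as an element of nat.\<close>
definition sigma :: "rat \<Rightarrow> int" where
  "sigma q = (if q = 0 then 1
              else if q \<in> \<nat> then int (\<Sum>d | d dvd nat \<lfloor>q\<rfloor>. d)
              else 0)"

end

theory Submission
  imports Defs "HOL-Computational_Algebra.Formal_Power_Series" "HOL-Library.Discrete_Functions"
begin

text \<open>
  Gauss's identity writes the generating function \<open>\<psi>\<close> of the triangular numbers as
  \<open>\<psi> = \<Prod>j\<ge>1. (1 - X^(2 j)) / (1 - X^(2 j - 1))\<close>. Taking logarithmic derivatives gives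
  \<open>X \<psi>' = \<psi> G\<close>, where the \<open>m\<close>-th coefficient of \<open>G\<close> is the sum of \<open>(-1)^(d + 1) d\<close> over the
  divisors \<open>d\<close> of \<open>m\<close>, which is \<open>\<sigma>(m) - 4 \<sigma>(m / 2)\<close>. Hence \<open>X (\<psi>\<^sup>2)' = 2 \<psi>\<^sup>2 G\<close>, and comparing
  coefficients at \<open>p\<close> yields \<open>p t\<^sub>2(p) = 2 (\<sigma>(p) - 4 \<sigma>(p / 2) + S)\<close> for the sum \<open>S\<close> in question.
  As \<open>p\<close> is odd, the first two terms give \<open>p + 1\<close>. The representations counted by \<open>t\<^sub>2(p)\<close> correspond
  to \<open>4 p + 1 = (x + y + 1)\<^sup>2 + (x - y)\<^sup>2\<close>, and a prime is a sum of two squares in only one way,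
  so \<open>t\<^sub>2(p) = 2\<close> and \<open>S = -1\<close>.
\<close>

unbundle fps_syntax

section \<open>Triangular numbers\<close>

definition tri :: "nat \<Rightarrow> nat" where
  "tri k = k * (k + 1) div 2"

lemma tri_Suc: "tri (Suc k) = tri k + Suc k"
proof -
  have "Suc k * (Suc k + 1) = k * (k + 1) + Suc k * 2"
    by (simp add: algebra_simps)
  then show ?thesis
    unfolding tri_def by (metis div_mult_self1 add.commute zero_neq_numeral)
qed

lemma double_tri: "2 * tri k = k * (k + 1)"
  by (simp add: tri_def)

lemma strict_mono_tri: "strict_mono tri"
  by (simp add: strict_mono_Suc_iff tri_Suc)

lemma tri_eq_iff [simp]: "tri j = tri k \<longleftrightarrow> j = k"
  using strict_mono_tri by (rule strict_mono_eq)

lemma tri_eq_0_iff: "tri k = 0 \<longleftrightarrow> k = 0"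
  by (cases k) (simp_all add: tri_Suc tri_def[of 0])

lemma tri_double: "tri (2 * n) = n * (2 * n + 1)"
  by (simp add: tri_def)

section \<open>Gauss's product and its finite form\<close>

definition ratio :: "nat \<Rightarrow> rat fps" where
  "ratio j = (1 - fps_X ^ (2 * j)) * inverse (1 - fps_X ^ (2 * j - 1))"

text \<open>The quotient of the \<open>n\<close>-th by the \<open>s\<close>-th partial product of
  Gauss's product. Its indices are positive, so the truncated exponent \<open>2 * j - 1\<close> in
  \<open>ratio\<close> is the true one.\<close>

definition partial_prod :: "nat \<Rightarrow> nat \<Rightarrow> rat fps" where
  "partial_prod s n = (\<Prod>j = Suc s..n. ratio j)"

lemma one_minus_fps_X_power_inverse:
  assumes "d > 0"
  shows "(1 - fps_X ^ d) * inverse (1 - fps_X ^ d) = (1 :: 'a::field fps)"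
  using assms by (intro inverse_mult_eq_1') simp

lemma partial_prod_self [simp]: "partial_prod n n = 1"
  by (simp add: partial_prod_def)

lemma partial_prod_Suc_right:
  "s \<le> n \<Longrightarrow> partial_prod s (Suc n) = partial_prod s n * ratio (Suc n)"
  by (simp add: partial_prod_def)

text \<open>Splits off the leading factor with its denominator cleared; in this form it turns
  \<open>G (Suc s)\<close> below into a multiple of \<open>partial_prod s n\<close>.\<close>

lemma partial_prod_Suc_left:
  assumes "s < n"
  shows "(1 - fps_X ^ (2 * s + 2)) * partial_prod (Suc s) n
       = (1 - fps_X ^ (2 * s + 1)) * partial_prod s n"
proof -
  have "partial_prod s n = ratio (Suc s) * partial_prod (Suc s) n"
    using assms by (simp add: partial_prod_def prod.atLeast_Suc_atMost)
  moreover have "(1 - fps_X ^ (2 * s + 1)) * ratio (Suc s) = 1 - fps_X ^ (2 * s + 2)"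
    using one_minus_fps_X_power_inverse[of "2 * s + 1", where 'a = rat]
    by (simp add: ratio_def mult.left_commute)
  ultimately show ?thesis
    by (simp flip: mult.assoc)
qed

text \<open>
  D. Shanks's finite form of Gauss's identity; modulo \<open>X^(2 n + 1)\<close> only the summand \<open>s = 0\<close> on
  the right of \<open>shanks_identity\<close> survives. In the induction on \<open>n\<close> the change of each summand
  telescopes in \<open>s\<close>, with the following \<open>G\<close>.
\<close>
lemma shanks_step:
  assumes "s < n"
  defines "b \<equiv> inverse (1 - fps_X ^ (2 * n + 1)) :: rat fps"
  defines "G \<equiv> \<lambda>s. partial_prod s n * (1 - fps_X ^ (2 * s)) * fps_X ^ (s * (2 * n + 1)) * b"
  shows "partial_prod s (Suc n) * fps_X ^ (s * (2 * n + 3))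
         - partial_prod s n * fps_X ^ (s * (2 * n + 1)) = G (Suc s) - G s"
proof -
  define Q where "Q = partial_prod s n"
  define x where "x = (fps_X ^ s :: rat fps)"
  define y where "y = (fps_X ^ n :: rat fps)"
  define z where "z = (fps_X ^ (s * (2 * n + 1)) :: rat fps)"
  have b: "(1 - y\<^sup>2 * fps_X) * b = 1"
    using one_minus_fps_X_power_inverse[of "2 * n + 1", where 'a = rat]
    by (simp add: b_def y_def power_add mult_ac flip: power_mult)
  have 1: "partial_prod s (Suc n) = Q * (1 - y\<^sup>2 * fps_X\<^sup>2) * b"
    using assms(1) by (simp add: partial_prod_Suc_right ratio_def Q_def y_def b_def
        power2_eq_square power_add mult_ac mult_2 mult_2_right)
  have 2: "fps_X ^ (s * (2 * n + 3)) = z * x\<^sup>2"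
    by (simp add: z_def x_def algebra_simps flip: power_add power_mult)
  have 3: "fps_X ^ (Suc s * (2 * n + 1)) = z * y\<^sup>2 * fps_X"
    by (simp add: z_def y_def algebra_simps power_add flip: power_mult)
  have 4: "fps_X ^ (2 * s) = x\<^sup>2" "fps_X ^ (2 * s + 1) = x\<^sup>2 * fps_X"
    by (simp_all add: x_def mult.commute flip: power_mult)
  have 5: "G (Suc s) = Q * (1 - x\<^sup>2 * fps_X) * (z * y\<^sup>2 * fps_X) * b"
  proof -
    have "G (Suc s) = ((1 - fps_X ^ (2 * s + 2)) * partial_prod (Suc s) n)
        * fps_X ^ (Suc s * (2 * n + 1)) * b"
      by (simp add: G_def mult_ac)
    also have "\<dots> = Q * (1 - x\<^sup>2 * fps_X) * (z * y\<^sup>2 * fps_X) * b"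
      unfolding partial_prod_Suc_left[OF assms(1)] 3 4 Q_def by (simp add: mult_ac)
    finally show ?thesis .
  qed
  \<comment> \<open>Writing the second term with the unit \<open>(1 - y\<^sup>2 * fps_X) * b\<close>
    gives all terms the common factor \<open>Q * z * b\<close>, so only a polynomial identity
    remains.\<close>
  have "Q * (1 - y\<^sup>2 * fps_X\<^sup>2) * b * (z * x\<^sup>2) - Q * z * ((1 - y\<^sup>2 * fps_X) * b)
      = Q * (1 - x\<^sup>2 * fps_X) * (z * y\<^sup>2 * fps_X) * b - Q * (1 - x\<^sup>2) * z * b"
    by (simp add: algebra_simps power2_eq_square)
  then show ?thesis
    unfolding 1 2 5 b mult_1_right
    unfolding G_def 4 Q_def[symmetric] z_def[symmetric] .
qed

lemma shanks_identity:
  "(\<Sum>k<2 * n. fps_X ^ tri k) = (\<Sum>s<n. partial_prod s n * fps_X ^ (s * (2 * n + 1)))"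
proof (induction n)
  case 0
  then show ?case by simp
next
  case (Suc n)
  define b :: "rat fps" where "b = inverse (1 - fps_X ^ (2 * n + 1))"
  define y :: "rat fps" where "y = fps_X ^ (2 * n)"
  define z :: "rat fps" where "z = fps_X ^ (n * (2 * n + 1))"
  define G where "G s = partial_prod s n * (1 - fps_X ^ (2 * s)) * fps_X ^ (s * (2 * n + 1)) * b"
    for s
  have b: "(1 - y * fps_X) * b = 1"
    using one_minus_fps_X_power_inverse[of "2 * n + 1", where 'a = rat]
    by (simp add: b_def y_def mult.commute)
  have "(\<Sum>s<n. partial_prod s (Suc n) * fps_X ^ (s * (2 * n + 3)))
        - (\<Sum>s<n. partial_prod s n * fps_X ^ (s * (2 * n + 1))) = (\<Sum>s<n. G (Suc s) - G s)"
    unfolding sum_subtractf[symmetric] G_def b_def by (intro sum.cong refl shanks_step) simp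
  \<comment> \<open>The boundary term \<open>G 0\<close> vanishes through its factor
    \<open>1 - fps_X ^ 0\<close>.\<close>
  also have "\<dots> = G n"
    by (simp add: sum_lessThan_telescope) (simp add: G_def)
  finally have 1: "(\<Sum>s<n. partial_prod s (Suc n) * fps_X ^ (s * (2 * n + 3)))
        = (\<Sum>k<2 * n. fps_X ^ tri k) + G n"
    by (simp only: Suc.IH diff_eq_eq add.commute)
  have 2: "G n = (1 - y) * z * b"
    by (simp add: G_def y_def z_def)
  \<comment> \<open>The summand \<open>s = n\<close> is new at \<open>Suc n\<close> and lies outside
    the telescoping. Together with \<open>G n\<close> it produces the two new powers
    \<open>fps_X ^ tri (2 * n)\<close> and \<open>fps_X ^ tri (2 * n + 1)\<close>.\<close>
  have 3: "partial_prod n (Suc n) * fps_X ^ (n * (2 * n + 3)) = (1 - y * fps_X\<^sup>2) * b * (z * y)"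
  proof -
    have "n * (2 * n + 3) = n * (2 * n + 1) + 2 * n" by (simp add: distrib_left)
    then have eq: "fps_X ^ (n * (2 * n + 3)) = z * y"
      by (simp only: z_def y_def power_add)
    show ?thesis
      unfolding eq
      by (simp add: partial_prod_Suc_right ratio_def b_def y_def power2_eq_square mult_ac)
  qed
  have 4: "fps_X ^ tri (2 * n) = z" "fps_X ^ tri (Suc (2 * n)) = z * y * fps_X"
    unfolding tri_Suc tri_double by (simp_all only: z_def y_def power_add power_Suc2 mult.assoc)
  have 5: "(1 - y) * z * b + (1 - y * fps_X\<^sup>2) * b * (z * y) = z + z * y * fps_X"
  proof -
    have "(1 - y) * z * b + (1 - y * fps_X\<^sup>2) * b * (z * y)
        = ((1 - y * fps_X) * b) * (z + z * y * fps_X)"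
      by (simp add: algebra_simps power2_eq_square)
    then show ?thesis by (simp only: b mult_1_left)
  qed
  have "2 * Suc n + 1 = 2 * n + 3" by simp
  then have "(\<Sum>s<Suc n. partial_prod s (Suc n) * fps_X ^ (s * (2 * Suc n + 1)))
      = (\<Sum>k<2 * n. fps_X ^ tri k) + G n + partial_prod n (Suc n) * fps_X ^ (n * (2 * n + 3))"
    by (simp only: sum.lessThan_Suc 1)
  also have "\<dots> = (\<Sum>k<2 * n. fps_X ^ tri k) + (z + z * y * fps_X)"
    by (simp only: 2 3 add.assoc 5)
  also have "\<dots> = (\<Sum>k<2 * Suc n. fps_X ^ tri k)"
    by (simp only: mult_Suc_right add_2_eq_Suc sum.lessThan_Suc 4 add.assoc)
  finally show ?case by simp
qed

text \<open>Since \<open>tri\<close> is injective, the indicator of its range counts each index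
  once.\<close>

definition psi :: "rat fps" where
  "psi = Abs_fps (\<lambda>m. if m \<in> range tri then 1 else 0)"

text \<open>In Shanks's identity the summands with \<open>s > 0\<close> have order at least
  \<open>2 * n + 1\<close>, and the missing powers \<open>fps_X ^ tri k\<close> with
  \<open>k \<ge> 2 * n\<close> have order at least \<open>n * (2 * n + 1) > 2 * n\<close>. Gauss's
  identity is thus available coefficientwise, without an infinite product.\<close>

lemma psi_nth_eq_partial_prod:
  assumes "n > 0" "m \<le> 2 * n"
  shows "psi $ m = partial_prod 0 n $ m"
proof -
  have "psi $ m = (\<Sum>k<2 * n. if m = tri k then 1 else 0)"
  proof (cases "m \<in> range tri")
    case True
    then obtain k where k: "m = tri k" by blast
    have "k < 2 * n"
    proof (rule ccontr)
      assume "\<not> k < 2 * n"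
      then have "tri (2 * n) \<le> tri k"
        using strict_mono_tri by (simp add: strict_mono_less_eq)
      moreover have "tri (2 * n) > 2 * n"
        unfolding tri_double using assms(1) by (cases n) simp_all
      ultimately show False using assms(2) k by simp
    qed
    then show ?thesis by (simp add: psi_def k)
  next
    case False
    then have "m \<noteq> tri k" for k by blast
    with False show ?thesis by (simp add: psi_def)
  qed
  also have "\<dots> = (\<Sum>k<2 * n. fps_X ^ tri k :: rat fps) $ m"
    by (simp add: fps_sum_nth)
  also have "\<dots> = (\<Sum>s<n. (partial_prod s n * fps_X ^ (s * (2 * n + 1))) $ m)"
    by (simp add: shanks_identity fps_sum_nth)
  also have "\<dots> = (\<Sum>s<n. if s = 0 then partial_prod 0 n $ m else 0)"
  proof (intro sum.cong refl)
    fix s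
    have "m < s * (2 * n + 1)" if "s > 0"
      using that assms(2) by (cases s) auto
    then show "(partial_prod s n * fps_X ^ (s * (2 * n + 1))) $ m
        = (if s = 0 then partial_prod 0 n $ m else 0)"
      by (auto simp: fps_X_power_mult_right_nth)
  qed
  finally show ?thesis using assms(1) by simp
qed

section \<open>Lambert series and logarithmic derivatives\<close>

text \<open>The series of \<open>X^d / (1 - X^d)\<close>. The condition \<open>m > 0\<close> removes
  the constant term, as \<open>d dvd 0\<close> always holds.\<close>

definition lambert :: "nat \<Rightarrow> rat fps" where
  "lambert d = Abs_fps (\<lambda>m. if m > 0 \<and> d dvd m then 1 else 0)"

lemma one_minus_fps_X_power_mult_lambert:
  assumes "d > 0"
  shows "(1 - fps_X ^ d) * lambert d = fps_X ^ d"
proof (rule fps_ext)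
  fix m
  have "d dvd m - d \<longleftrightarrow> d dvd m" if "d \<le> m"
    using that by (metis dvd_minus_self leD)
  then show "((1 - fps_X ^ d) * lambert d) $ m = fps_X ^ d $ m"
    using assms by (auto simp: left_diff_distrib fps_X_power_mult_nth lambert_def
        dest: dvd_imp_le)
qed

text \<open>States \<open>g = X f' / f\<close> without division; the factor \<open>X\<close> makes
  the \<open>m\<close>-th coefficient on the left \<open>m\<close> times that of
  \<open>f\<close>.\<close>

definition has_log_deriv :: "'a::comm_ring_1 fps \<Rightarrow> 'a fps \<Rightarrow> bool" where
  "has_log_deriv f g \<longleftrightarrow> fps_X * fps_deriv f = f * g"

lemma has_log_deriv_mult:
  assumes "has_log_deriv f g" "has_log_deriv f' g'"
  shows "has_log_deriv (f * f') (g + g')"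
proof -
  have "fps_X * fps_deriv (f * f') = f * (fps_X * fps_deriv f') + (fps_X * fps_deriv f) * f'"
    by (simp add: algebra_simps)
  also have "\<dots> = f * (f' * g') + (f * g) * f'"
    using assms by (simp only: has_log_deriv_def)
  finally show ?thesis
    by (simp only: has_log_deriv_def distrib_left add.commute mult_ac)
qed

lemma has_log_deriv_unit_inverse:
  assumes "has_log_deriv f g" "f * h = 1"
  shows "has_log_deriv h (- g)"
proof -
  have "fps_deriv (f * h) = 0"
    using assms(2) by simp
  then have deriv: "f * fps_deriv h = - (fps_deriv f * h)"
    by (simp add: eq_neg_iff_add_eq_0)
  have "fps_X * fps_deriv h = (f * h) * (fps_X * fps_deriv h)"
    using assms(2) by simp
  also have "\<dots> = h * (fps_X * (f * fps_deriv h))"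
    by (simp only: mult_ac)
  also have "\<dots> = - ((fps_X * fps_deriv f) * h * h)"
    by (simp add: deriv mult_ac)
  also have "\<dots> = - ((f * h) * (h * g))"
    using assms(1) by (simp add: has_log_deriv_def mult_ac)
  finally show ?thesis
    using assms(2) by (simp add: has_log_deriv_def)
qed

lemma has_log_deriv_one_minus_fps_X_power:
  assumes "d > 0"
  shows "has_log_deriv (1 - fps_X ^ d) (- (of_nat d * lambert d))"
proof -
  have "fps_X * fps_deriv (1 - fps_X ^ d :: rat fps) = - (of_nat d * (fps_X * fps_X ^ (d - 1)))"
    by (simp add: fps_deriv_power' mult_ac)
  also have "fps_X * fps_X ^ (d - 1) = (fps_X ^ d :: rat fps)"
    using assms by (cases d) auto
  also have "of_nat d * \<dots> = of_nat d * ((1 - fps_X ^ d) * lambert d)"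
    using assms by (simp add: one_minus_fps_X_power_mult_lambert)
  finally show ?thesis
    by (simp only: has_log_deriv_def mult_minus_right mult.left_commute)
qed

text \<open>Even \<open>d\<close> come from numerators and contribute \<open>-d\<close>, odd
  \<open>d\<close> come from denominators and contribute \<open>+d\<close>; hence the sign
  \<open>(-1) ^ (d + 1)\<close>.\<close>

lemma has_log_deriv_partial_prod:
  "has_log_deriv (partial_prod 0 n) (\<Sum>d = 1..2 * n. (-1) ^ (d + 1) * of_nat d * lambert d)"
proof (induction n)
  case 0
  then show ?case by (simp add: has_log_deriv_def)
next
  case (Suc n)
  have "has_log_deriv (inverse (1 - fps_X ^ (2 * n + 1)))
      (- (- (of_nat (2 * n + 1) * lambert (2 * n + 1))))"
    using one_minus_fps_X_power_inverse[of "2 * n + 1"]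
    by (intro has_log_deriv_unit_inverse[OF has_log_deriv_one_minus_fps_X_power]) auto
  then have "has_log_deriv (partial_prod 0 n * ((1 - fps_X ^ (2 * n + 2)) *
        inverse (1 - fps_X ^ (2 * n + 1))))
      ((\<Sum>d = 1..2 * n. (-1) ^ (d + 1) * of_nat d * lambert d)
       + (- (of_nat (2 * n + 2) * lambert (2 * n + 2))
          + - (- (of_nat (2 * n + 1) * lambert (2 * n + 1)))))"
    by (intro has_log_deriv_mult Suc.IH has_log_deriv_one_minus_fps_X_power) auto
  also have "partial_prod 0 n * ((1 - fps_X ^ (2 * n + 2)) *
        inverse (1 - fps_X ^ (2 * n + 1))) = partial_prod 0 (Suc n)"
    by (simp add: partial_prod_Suc_right ratio_def)
  also have "(\<Sum>d = 1..2 * n. (-1) ^ (d + 1) * of_nat d * lambert d)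
       + (- (of_nat (2 * n + 2) * lambert (2 * n + 2))
          + - (- (of_nat (2 * n + 1) * lambert (2 * n + 1))))
     = (\<Sum>d = 1..2 * Suc n. (-1) ^ (d + 1) * of_nat d * lambert d)"
    by (simp add: algebra_simps)
  finally show ?case .
qed

definition alt_sigma :: "nat \<Rightarrow> int" where
  "alt_sigma m = (\<Sum>d | d dvd m. (-1) ^ (d + 1) * int d)"

definition alt_sigma_fps :: "rat fps" where
  "alt_sigma_fps = Abs_fps (\<lambda>m. if m = 0 then 0 else of_int (alt_sigma m))"

text \<open>Any cutoff \<open>N \<ge> m\<close> works, because a positive \<open>m\<close> has no
  divisor above \<open>m\<close> and every \<open>lambert d\<close> has constant term 0.\<close>

lemma alt_sigma_fps_nth:
  assumes "m \<le> N"
  shows "alt_sigma_fps $ m = (\<Sum>d = 1..N. (-1) ^ (d + 1) * of_nat d * lambert d) $ m"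
proof -
  have [simp]: "((-1) ^ k :: rat fps) = fps_const ((-1) ^ k)" for k
    by (metis fps_const_1_eq_1 fps_const_neg fps_const_power)
  have *: "((-1) ^ (d + 1) * of_nat d * lambert d) $ m
      = (if m > 0 \<and> d dvd m then (-1) ^ (d + 1) * of_nat d else 0)" for d
    by (simp add: lambert_def mult.assoc flip: fps_of_nat)
  have "(\<Sum>d = 1..N. (-1) ^ (d + 1) * of_nat d * lambert d) $ m
      = (\<Sum>d = 1..N. if m > 0 \<and> d dvd m then (-1) ^ (d + 1) * of_nat d else 0)"
    unfolding fps_sum_nth * ..
  also have "\<dots> = alt_sigma_fps $ m"
  proof (cases "m = 0")
    case True
    then show ?thesis by (simp add: alt_sigma_fps_def)
  next
    case False
    then have "{d. d dvd m} = {d \<in> {1..N}. d dvd m}"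
      using assms by (auto dest: dvd_imp_le intro: Suc_leI)
    then show ?thesis using False
      by (simp add: alt_sigma_fps_def alt_sigma_def flip: sum.inter_filter)
  qed
  finally show ?thesis by simp
qed

text \<open>The \<open>m\<close>-th coefficients of both sides involve only coefficients up to
  \<open>m\<close>, where \<open>psi\<close> and \<open>alt_sigma_fps\<close> agree with their
  truncations at \<open>n = Suc m\<close>.\<close>

lemma has_log_deriv_psi: "has_log_deriv psi alt_sigma_fps"
  unfolding has_log_deriv_def
proof (rule fps_ext)
  fix m
  define n where "n = Suc m"
  define L :: "rat fps" where "L = (\<Sum>d = 1..2 * n. (-1) ^ (d + 1) * of_nat d * lambert d)"
  have nth: "psi $ i = partial_prod 0 n $ i" "alt_sigma_fps $ i = L $ i" if "i \<le> m" for i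
    using that psi_nth_eq_partial_prod[of n i] alt_sigma_fps_nth[of i "2 * n"]
    by (simp_all add: n_def L_def)
  have "(fps_X * fps_deriv psi) $ m = (fps_X * fps_deriv (partial_prod 0 n)) $ m"
    using nth(1)[of m] by (cases m) simp_all
  also have "\<dots> = (partial_prod 0 n * L) $ m"
    using has_log_deriv_partial_prod[of n] by (simp add: has_log_deriv_def L_def)
  also have "\<dots> = (psi * alt_sigma_fps) $ m"
    unfolding fps_mult_nth by (intro sum.cong refl) (simp add: nth)
  finally show "(fps_X * fps_deriv psi) $ m = (psi * alt_sigma_fps) $ m" .
qed

section \<open>The recurrence for \<open>t2\<close>\<close>

text \<open>The Cauchy product counts the \<open>i \<le> m\<close> with \<open>i\<close> and
  \<open>m - i\<close> both triangular; by injectivity of \<open>tri\<close> such an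
  \<open>i\<close> determines the pair \<open>(x, y)\<close>.\<close>

lemma psi_square_nth: "(psi * psi) $ m = of_nat (t2 m)"
proof -
  define A where "A = {i \<in> {0..m}. i \<in> range tri \<and> m - i \<in> range tri}"
  define B where "B = {(x, y). m = tri x + tri y}"
  have "(psi * psi) $ m = (\<Sum>i = 0..m. if i \<in> range tri \<and> m - i \<in> range tri then 1 else 0)"
    unfolding fps_mult_nth by (intro sum.cong refl) (simp add: psi_def)
  also have "\<dots> = of_nat (card A)"
    by (simp add: A_def flip: sum.inter_filter)
  also have "bij_betw (\<lambda>(x, y). tri x) B A"
    unfolding bij_betw_def
  proof
    show "inj_on (\<lambda>(x, y). tri x) B"
      by (auto simp: inj_on_def B_def)
    show "(\<lambda>(x, y). tri x) ` B = A"
    proof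
      show "(\<lambda>(x, y). tri x) ` B \<subseteq> A"
        by (auto simp: A_def B_def)
      show "A \<subseteq> (\<lambda>(x, y). tri x) ` B"
      proof
        fix i assume i: "i \<in> A"
        then obtain x y where "i = tri x" "m - i = tri y" "i \<le> m"
          by (auto simp: A_def)
        then have "(x, y) \<in> B" "i = (\<lambda>(x, y). tri x) (x, y)"
          by (auto simp: B_def)
        then show "i \<in> (\<lambda>(x, y). tri x) ` B" by (rule rev_image_eqI)
      qed
    qed
  qed
  then have "card A = card B"
    by (simp add: bij_betw_same_card)
  finally show ?thesis
    by (simp add: B_def t2_def tri_def)
qed

lemma t2_recurrence:
  "int n * int (t2 n) = 2 * (\<Sum>j<n. int (t2 j) * alt_sigma (n - j))"
proof -
  have "has_log_deriv (psi * psi) (alt_sigma_fps + alt_sigma_fps)"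
    by (intro has_log_deriv_mult has_log_deriv_psi)
  then have "(fps_X * fps_deriv (psi * psi)) $ n
      = 2 * ((psi * psi) * alt_sigma_fps) $ n"
    unfolding has_log_deriv_def by (simp only: distrib_left fps_add_nth mult_2)
  moreover have "(fps_X * fps_deriv (psi * psi)) $ n = of_nat n * of_nat (t2 n)"
    using psi_square_nth[of n]
    by (cases n) (simp_all del: fps_deriv_mult)
  moreover have "((psi * psi) * alt_sigma_fps) $ n
      = (\<Sum>j<n. of_nat (t2 j) * of_int (alt_sigma (n - j)))"
  proof -
    have "((psi * psi) * alt_sigma_fps) $ n
        = (\<Sum>j = 0..n. of_nat (t2 j) * alt_sigma_fps $ (n - j))"
      by (simp only: fps_mult_nth[of "psi * psi"] psi_square_nth)
    \<comment> \<open>The term \<open>j = n\<close> drops out because \<open>alt_sigma_fps\<close>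
      has constant term 0.\<close>
    also have "\<dots> = (\<Sum>j<n. of_nat (t2 j) * alt_sigma_fps $ (n - j))"
      by (simp add: atLeast0AtMost lessThan_Suc_atMost[symmetric] alt_sigma_fps_def)
    also have "\<dots> = (\<Sum>j<n. of_nat (t2 j) * of_int (alt_sigma (n - j)))"
      by (intro sum.cong refl) (simp add: alt_sigma_fps_def)
    finally show ?thesis .
  qed
  ultimately have "(of_int (int n * int (t2 n)) :: rat)
      = of_int (2 * (\<Sum>j<n. int (t2 j) * alt_sigma (n - j)))"
    by simp
  then show ?thesis by (simp only: of_int_eq_iff)
qed

section \<open>Alternating divisor sums in terms of \<open>sigma\<close>\<close>

lemma sigma_of_nat: "m > 0 \<Longrightarrow> sigma (of_nat m) = (\<Sum>d | d dvd m. int d)"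
  by (simp add: sigma_def)

lemma sigma_half_odd:
  assumes "odd m"
  shows "sigma (of_nat m / 2) = 0"
proof -
  have "of_nat m / 2 \<noteq> (of_nat k :: rat)" for k
  proof
    assume "of_nat m / 2 = (of_nat k :: rat)"
    then have "(of_nat m :: rat) = of_nat (2 * k)" by (simp add: field_simps)
    then have "m = 2 * k" by (simp only: of_nat_eq_iff)
    then show False using assms by simp
  qed
  then have "(of_nat m / 2 :: rat) \<notin> \<nat>" by (auto elim!: Nats_cases)
  moreover have "m \<noteq> 0" using assms by (rule odd_pos[THEN gr_implies_not0])
  ultimately show ?thesis by (simp add: sigma_def)
qed

text \<open>Reversing the sign of an even divisor \<open>d\<close> costs \<open>2 d\<close>. For
  \<open>m = 2 k\<close> the even divisors are the doubles of the divisors of \<open>k\<close>, so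
  the total cost is four times \<open>sigma\<close> at \<open>k\<close>; for odd \<open>m\<close>
  both sides of this correction are 0.\<close>

lemma alt_sigma_eq_sigma:
  assumes "m > 0"
  shows "sigma (of_nat m) - 4 * sigma (of_nat m / 2) = alt_sigma m"
proof -
  have fin: "finite {d. d dvd m}" using assms by simp
  have "alt_sigma m = (\<Sum>d | d dvd m. int d - (if even d then 2 * int d else 0))"
    unfolding alt_sigma_def by (intro sum.cong refl) auto
  also have "\<dots> = sigma (of_nat m) - (\<Sum>d \<in> {d. d dvd m} \<inter> {d. even d}. 2 * int d)"
    using assms fin by (simp add: sum_subtractf sigma_of_nat sum.If_cases)
  also have "(\<Sum>d \<in> {d. d dvd m} \<inter> {d. even d}. 2 * int d) = 4 * sigma (of_nat m / 2)"
  proof (cases "even m")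
    case False
    then have "{d. d dvd m} \<inter> {d. even d} = {}"
      using dvd_trans by blast
    with False show ?thesis by (simp add: sigma_half_odd)
  next
    case True
    then obtain k where k: "m = 2 * k" by blast
    have "{d. d dvd m} \<inter> {d. even d} = (\<lambda>d. 2 * d) ` {d. d dvd k}"
      by (auto simp: k elim!: evenE)
    then have "(\<Sum>d \<in> {d. d dvd m} \<inter> {d. even d}. 2 * int d) = (\<Sum>d | d dvd k. 4 * int d)"
      by (simp add: sum.reindex inj_on_def)
    also have "\<dots> = 4 * sigma (of_nat k)"
      using assms k by (simp add: sigma_of_nat sum_distrib_left)
    also have "of_nat k = (of_nat m / 2 :: rat)"
      by (simp add: k)
    finally show ?thesis .
  qed
  finally show ?thesis by simp
qed

section \<open>Primes as sums of two squares\<close>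

text \<open>Euler's criterion applies with the even exponent \<open>(q - 1) div 2\<close>, so the
  Legendre symbol of -1 is congruent to 1.\<close>

lemma prime_1_mod_4_sqrt_minus_one:
  fixes q :: nat
  assumes "prime q" "q mod 4 = 1"
  obtains r :: int where "[r\<^sup>2 = -1] (mod int q)"
proof -
  have q: "q > 2" using assms prime_ge_2_nat[of q] by (cases "q = 2") auto
  have "even ((q - 1) div 2)" using assms(2) by presburger
  then have "[Legendre (-1) (int q) = 1] (mod int q)"
    using euler_criterion[OF assms(1) q, of "-1"] by simp
  have "Legendre (-1) (int q) \<noteq> -1"
  proof
    assume "Legendre (-1) (int q) = -1"
    with \<open>[Legendre (-1) (int q) = 1] (mod int q)\<close> have "int q dvd 2"
      by (simp add: cong_iff_dvd_diff)
    then show False using q by (auto dest!: zdvd_imp_le)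
  qed
  then have "QuadRes (int q) (-1) \<or> [-1 = 0] (mod int q)"
    by (auto simp: Legendre_def split: if_splits)
  moreover have "\<not> [-1 = 0] (mod int q)"
    using q by (simp add: cong_iff_dvd_diff)
  ultimately show ?thesis
    using that by (auto simp: QuadRes_def)
qed

text \<open>For a root \<open>r\<close> of -1 there are small \<open>a\<close>, \<open>b\<close>,
  not both 0, with \<open>b\<close> congruent to \<open>a * r\<close>. Then \<open>q\<close> divides
  the sum of their squares, which lies strictly between 0 and \<open>2 * q\<close>.\<close>

lemma prime_1_mod_4_sum_two_squares:
  fixes q :: nat
  assumes "prime q" "q mod 4 = 1"
  obtains a b :: int where "int q = a\<^sup>2 + b\<^sup>2"
proof -
  obtain r where r: "[r\<^sup>2 = -1] (mod int q)"
    using prime_1_mod_4_sqrt_minus_one assms by blast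
  define m where "m = floor_sqrt q"
  have q: "q > 1" using assms(1) by (rule prime_gt_1_nat)
  have "m\<^sup>2 \<le> q" by (simp add: m_def)
  \<comment> \<open>A prime is not a square; the strict inequality is what later keeps the sum of
    two squares below \<open>2 * q\<close>.\<close>
  moreover have "m\<^sup>2 \<noteq> q"
    using assms(1) by (metis prime_power_iff zero_neq_numeral numeral_eq_one_iff
        semiring_norm(85))
  ultimately have m: "m\<^sup>2 < q" by simp
  have "q < (m + 1)\<^sup>2" using Suc_floor_sqrt_power2_gt[of q] by (simp add: m_def)
  \<comment> \<open>Thue's pigeonhole argument\<close>
  define f where "f = (\<lambda>(x, y). (int x * r - int y) mod int q)"
  have "\<not> inj_on f ({0..m} \<times> {0..m})"
  proof
    assume "inj_on f ({0..m} \<times> {0..m})"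
    moreover have "f ` ({0..m} \<times> {0..m}) \<subseteq> {0..<int q}"
      using q by (auto simp: f_def)
    ultimately have "card ({0..m} \<times> {0..m}) \<le> card {0..<int q}"
      by (intro card_inj_on_le) auto
    then show False
      using \<open>q < (m + 1)\<^sup>2\<close> by (simp add: card_cartesian_product power2_eq_square)
  qed
  then obtain x y x' y' where xy: "x \<le> m" "y \<le> m" "x' \<le> m" "y' \<le> m" "(x, y) \<noteq> (x', y')"
    "f (x, y) = f (x', y')"
    by (auto simp: inj_on_def)
  define a where "a = int x - int x'"
  define b where "b = int y - int y'"
  have "[a * r = b] (mod int q)"
    using xy(6) unfolding f_def a_def b_def prod.case cong_def[symmetric] cong_iff_dvd_diff
    by (simp add: algebra_simps)
  then have "[(a * r)\<^sup>2 = b\<^sup>2] (mod int q)"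
    by (rule cong_pow)
  moreover have "[a\<^sup>2 * r\<^sup>2 = a\<^sup>2 * (-1)] (mod int q)"
    using r by (rule cong_scalar_left)
  ultimately have "[a\<^sup>2 * (-1) = b\<^sup>2] (mod int q)"
    unfolding power_mult_distrib using cong_sym cong_trans by blast
  then have "int q dvd - (a\<^sup>2 + b\<^sup>2)"
    unfolding cong_iff_dvd_diff by (simp add: algebra_simps)
  then obtain k where k: "a\<^sup>2 + b\<^sup>2 = int q * k"
    unfolding dvd_minus_iff by blast
  have "\<bar>a\<bar> \<le> int m" "\<bar>b\<bar> \<le> int m"
    using xy by (auto simp: a_def b_def)
  then have "a\<^sup>2 \<le> (int m)\<^sup>2" "b\<^sup>2 \<le> (int m)\<^sup>2"
    by (simp_all add: abs_le_square_iff[symmetric])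
  moreover have "(int m)\<^sup>2 < int q"
    using m by (metis of_nat_less_iff of_nat_power)
  ultimately have "int q * k < int q * 2"
    using k by linarith
  then have "k < 2" using q by simp
  have "a \<noteq> 0 \<or> b \<noteq> 0" using xy(5) by (auto simp: a_def b_def)
  then have "int q * k > 0" using k by (metis sum_power2_gt_zero_iff)
  then have "k > 0" using q by (simp add: zero_less_mult_iff)
  with \<open>k < 2\<close> have "k = 1" by simp
  with k that[of a b] show ?thesis by simp
qed

text \<open>The prime divides \<open>(a d - b c) (a d + b c)\<close>, and each choice of factor
  forces one of the two matchings.\<close>

lemma prime_sum_two_squares_unique:
  fixes a b c d q :: int
  assumes "prime q" "q = a\<^sup>2 + b\<^sup>2" "q = c\<^sup>2 + d\<^sup>2" "a > 0" "b > 0" "c > 0" "d > 0"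
  shows "a = c \<and> b = d \<or> a = d \<and> b = c"
proof -
  have q: "q > 0" using assms(1) by (rule prime_gt_0_int)
  have "b\<^sup>2 = q - a\<^sup>2" "d\<^sup>2 = q - c\<^sup>2"
    using assms(2,3) by simp_all
  have "(a * d - b * c) * (a * d + b * c) = a\<^sup>2 * d\<^sup>2 - b\<^sup>2 * c\<^sup>2"
    by (simp add: algebra_simps power2_eq_square)
  also have "\<dots> = a\<^sup>2 * (q - c\<^sup>2) - (q - a\<^sup>2) * c\<^sup>2"
    by (simp only: \<open>b\<^sup>2 = _\<close> \<open>d\<^sup>2 = _\<close>)
  also have "\<dots> = q * (a\<^sup>2 - c\<^sup>2)"
    by (simp add: algebra_simps)
  finally have "(a * d - b * c) * (a * d + b * c) = q * (a\<^sup>2 - c\<^sup>2)" .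
  then have "q dvd (a * d - b * c) * (a * d + b * c)" by simp
  then consider "q dvd a * d + b * c" | "q dvd a * d - b * c"
    using assms(1) prime_dvd_mult_iff by blast
  then show ?thesis
  proof cases
    case 1
    \<comment> \<open>A positive multiple of \<open>q\<close> is at least \<open>q\<close>, which
      leaves no room for \<open>(a - d)^2 + (b - c)^2\<close> to be positive.\<close>
    have "0 < a * d + b * c" using assms by (simp add: add_pos_pos)
    with 1 have "q \<le> a * d + b * c" by (rule zdvd_imp_le)
    moreover have "(a - d)\<^sup>2 + (b - c)\<^sup>2
        = (a\<^sup>2 + b\<^sup>2) + (c\<^sup>2 + d\<^sup>2) - 2 * (a * d + b * c)"
      by (simp add: power2_eq_square algebra_simps)
    ultimately have "(a - d)\<^sup>2 + (b - c)\<^sup>2 \<le> 0"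
      unfolding assms(2,3)[symmetric] by simp
    then show ?thesis by (simp add: sum_power2_le_zero_iff)
  next
    case 2
    \<comment> \<open>Brahmagupta's identity bounds \<open>|a d - b c|\<close> strictly below
      \<open>q\<close>, so this multiple of \<open>q\<close> is 0 and
      \<open>a c + b d = q\<close>.\<close>
    have "(a * d - b * c)\<^sup>2 + (a * c + b * d)\<^sup>2
        = (a\<^sup>2 + b\<^sup>2) * (c\<^sup>2 + d\<^sup>2)"
      by (simp add: power2_eq_square algebra_simps)
    then have sq: "(a * d - b * c)\<^sup>2 + (a * c + b * d)\<^sup>2 = q\<^sup>2"
      unfolding assms(2,3)[symmetric] by (simp add: power2_eq_square)
    have pos: "0 < a * c + b * d" using assms by (simp add: add_pos_pos)
    then have "(a * c + b * d)\<^sup>2 > 0" by simp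
    with sq have "(a * d - b * c)\<^sup>2 < q\<^sup>2" by linarith
    then have "\<bar>a * d - b * c\<bar> < q"
      using q by (intro power2_less_imp_less[of "\<bar>a * d - b * c\<bar>" q]) simp_all
    with 2 have "a * d - b * c = 0"
      using dvd_imp_le_int[of "a * d - b * c" q] by linarith
    with sq have "(a * c + b * d)\<^sup>2 = q\<^sup>2" by simp
    then have "a * c + b * d = q" using pos q by (simp add: power2_eq_iff_nonneg)
    moreover have "(a - c)\<^sup>2 + (b - d)\<^sup>2
        = (a\<^sup>2 + b\<^sup>2) + (c\<^sup>2 + d\<^sup>2) - 2 * (a * c + b * d)"
      by (simp add: power2_eq_square algebra_simps)
    ultimately have "(a - c)\<^sup>2 + (b - d)\<^sup>2 = 0"
      unfolding assms(2,3)[symmetric] by simp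
    then show ?thesis by (simp add: sum_power2_eq_zero_iff)
  qed
qed

section \<open>Representations of \<open>n\<close> when \<open>4 * n + 1\<close> is prime\<close>

lemma t2_eq_2:
  assumes "prime (4 * n + 1)"
  shows "t2 n = 2"
proof -
  define q where "q = int (4 * n + 1)"
  have q: "prime q" using assms unfolding q_def by (simp only: prime_int_nat_transfer nat_int) simp
  have nonsquare: "q \<noteq> x\<^sup>2" for x
    using q prime_power_iff[of x 2] by auto
  obtain a b where "q = a\<^sup>2 + b\<^sup>2"
    using prime_1_mod_4_sum_two_squares[OF assms] unfolding q_def by auto
  then have ab: "q = \<bar>a\<bar>\<^sup>2 + \<bar>b\<bar>\<^sup>2" by simp
  have "odd q" by (simp add: q_def)
  then have "odd (\<bar>a\<bar> + \<bar>b\<bar>)" unfolding ab by simp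
  then have "\<bar>a\<bar> \<noteq> \<bar>b\<bar>" by (metis even_add)
  have "a \<noteq> 0" "b \<noteq> 0" using ab nonsquare[of a] nonsquare[of b] by auto
  \<comment> \<open>The parts are ordered because \<open>x + y + 1\<close> always exceeds
    \<open>|x - y|\<close>; so the former must be \<open>u\<close> and the latter
    \<open>v\<close>.\<close>
  define u where "u = max \<bar>a\<bar> \<bar>b\<bar>"
  define v where "v = min \<bar>a\<bar> \<bar>b\<bar>"
  have uv: "q = u\<^sup>2 + v\<^sup>2" "0 < v" "v < u" "odd (u + v)"
    using ab \<open>odd (\<bar>a\<bar> + \<bar>b\<bar>)\<close> \<open>\<bar>a\<bar> \<noteq> \<bar>b\<bar>\<close> \<open>a \<noteq> 0\<close> \<open>b \<noteq> 0\<close>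
    by (auto simp: u_def v_def max_def min_def)
  \<comment> \<open>Solving \<open>h + k + 1 = u\<close> and \<open>h - k = v\<close> gives
    \<open>k = (u - v - 1) / 2\<close> and \<open>h = k + v\<close>.\<close>
  have "even (u - v - 1)" using uv(4) by simp
  then obtain w where w: "u - v - 1 = 2 * w" by blast
  define k where "k = nat w"
  define h where "h = k + nat v"
  have k: "int k = w" "int h = w + v" using w uv by (auto simp: k_def h_def)
  have "h \<noteq> k" using uv by (simp add: h_def)
  have iff: "n = tri x + tri y \<longleftrightarrow> q = (int x + int y + 1)\<^sup>2 + \<bar>int x - int y\<bar>\<^sup>2" for x y
  proof -
    have "n = tri x + tri y \<longleftrightarrow> 2 * int n = 2 * int (tri x) + 2 * int (tri y)" by linarith
    also have "\<dots> \<longleftrightarrow> 2 * int n = int x * (int x + 1) + int y * (int y + 1)"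
      using double_tri[of x] double_tri[of y]
      by (metis (no_types, lifting) of_nat_1 of_nat_add of_nat_mult of_nat_numeral)
    also have "\<dots> \<longleftrightarrow> q = (int x + int y + 1)\<^sup>2 + (int x - int y)\<^sup>2"
      unfolding q_def by (simp add: power2_eq_square algebra_simps) linarith
    finally show ?thesis by simp
  qed
  have "n = tri x + tri y \<longleftrightarrow> x = h \<and> y = k \<or> x = k \<and> y = h" for x y
  proof
    assume "n = tri x + tri y"
    then have xy: "q = (int x + int y + 1)\<^sup>2 + \<bar>int x - int y\<bar>\<^sup>2" by (simp only: iff)
    \<comment> \<open>For \<open>x = y\<close> the prime \<open>q\<close> would be a square.\<close>
    then have "\<bar>int x - int y\<bar> > 0" using nonsquare by (cases "x = y") auto
    moreover have "0 < int x + int y + 1" "0 < u" using uv(2,3) by simp_all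
    ultimately have "int x + int y + 1 = u \<and> \<bar>int x - int y\<bar> = v
        \<or> int x + int y + 1 = v \<and> \<bar>int x - int y\<bar> = u"
      using uv(2) by (intro prime_sum_two_squares_unique[OF q xy uv(1)])
    then show "x = h \<and> y = k \<or> x = k \<and> y = h"
      using w k uv(3) by linarith
  next
    assume "x = h \<and> y = k \<or> x = k \<and> y = h"
    then have "int x + int y + 1 = u \<and> \<bar>int x - int y\<bar> = v"
      using w k uv(2) by auto
    then show "n = tri x + tri y"
      using uv(1) by (simp only: iff)
  qed
  then have "{(x, y). n = tri x + tri y} = {(h, k), (k, h)}"
    by auto
  then have "t2 n = card {(h, k), (k, h)}"
    by (simp add: t2_def tri_def)
  with \<open>h \<noteq> k\<close> show ?thesis by simp
qed

section \<open>Evaluation of the sum at \<open>p\<close>\<close>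

lemma t2_0: "t2 0 = 1"
proof -
  have "{(x, y). 0 = tri x + tri y} = {(0, 0)}"
    by (auto simp: tri_eq_0_iff)
  then show ?thesis by (simp add: t2_def tri_def)
qed

theorem theorem4p1:
  fixes p :: nat
  assumes "prime p" and "prime (4 * p + 1)"
  shows "(\<Sum>j = 1..p - 1. int (t2 j) *
           (sigma (of_nat p - of_nat j) - 4 * sigma ((of_nat p - of_nat j) / 2))) = -1"
    (is "?S = _")
proof -
  have "p > 1" using assms(1) by (rule prime_gt_1_nat)
  have "p \<noteq> 2"
  proof
    assume "p = 2"
    with assms(2) have "prime (3 ^ 2 :: nat)" by simp
    then show False unfolding prime_power_iff by simp
  qed
  then have "odd p" using assms(1) \<open>p > 1\<close> prime_odd_nat by auto
  have "?S = (\<Sum>j = 1..p - 1. int (t2 j) * alt_sigma (p - j))"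
  proof (intro sum.cong refl)
    fix j assume "j \<in> {1..p - 1}"
    then have j: "j \<le> p" "p - j > 0" using \<open>p > 1\<close> by auto
    show "int (t2 j) * (sigma (of_nat p - of_nat j) - 4 * sigma ((of_nat p - of_nat j) / 2))
        = int (t2 j) * alt_sigma (p - j)"
      unfolding of_nat_diff[OF j(1), symmetric] alt_sigma_eq_sigma[OF j(2)] ..
  qed
  \<comment> \<open>The recurrence starts at \<open>j = 0\<close>, and this summand is
    \<open>alt_sigma p\<close> since \<open>t2 0 = 1\<close>.\<close>
  moreover have "(\<Sum>j<p. int (t2 j) * alt_sigma (p - j))
      = alt_sigma p + (\<Sum>j = 1..p - 1. int (t2 j) * alt_sigma (p - j))"
  proof -
    have "{..<p} = insert 0 {1..p - 1}" using \<open>p > 1\<close> by auto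
    then show ?thesis by (simp add: t2_0)
  qed
  moreover have "alt_sigma p = int p + 1"
  proof -
    have "{d. d dvd p} = {1, p}"
      using assms(1) by (auto simp: prime_nat_iff)
    then show ?thesis using \<open>p > 1\<close> \<open>odd p\<close> by (simp add: alt_sigma_def)
  qed
  \<comment> \<open>The recurrence now reads \<open>2 p = 2 (p + 1 + S)\<close>, where
    \<open>S\<close> is the sum in question.\<close>
  ultimately show ?thesis
    using t2_recurrence[of p] by (simp add: t2_eq_2[OF assms(2)])
qed

end
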